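(* Let $k\ge1$ be an integer. In two dimensions, the family $\{A^{2k}_\varepsilon\}_{\varepsilon>0}$ of $2k$-averages over the vertices of a regular $(2k+2)$-gon of radius $\varepsilon$ has the asymptotic mean value property for the $p=2k$-Laplacian with constant $c_{2k,2}=\tfrac12$. That is: let $\Omega\subset\mathbb{R}^2$ be a bounded domain, and let $\Omega_E=\{x\in\mathbb{R}^2:\operatorname{dist}(x,\Omega)<1\}$. For every $\phi\in C_b^\infty(\Omega_E)$ with $\nabla\phi\neq0$ everywhere on $\Omega_E$, $$\phi(x)=A^{2k}_\varepsilon[\phi](x)+\tfrac12\,\varepsilon^2\left(-\Delta_{2k}^G\phi(x)\right)+o(\varepsilon^2)\quad\text{as }\varepsilon\to0^+,$$ uniformly for $x\in\Omega$.
   Context: $C_b^\infty(\Omega_E)$ denotes the smooth functions on $\Omega_E$ which are bounded together with all their derivatives. For $x\in\Omega$ and $\varepsilon>0$ small enough that the closed ball of radius $\varepsilon$ about $x$ lies in $\Omega_E$, $A^{2k}_\varepsilon[\phi](x)$ is the unique minimizer over $c\in\mathbb{R}$ of $\sum_{j=0}^{2k+1}|\phi(x+\xi_j)-c|^{2k}$, where $\xi_j=\varepsilon\left(\cos\frac{2\pi j}{2k+2},\sin\frac{2\pi j}{2k+2}\right)$, $j=0,\dots,2k+1$. The game (normalized) $p$-Laplacian of a smooth function $u$ at points where $\nabla u\ne0$ is $$\Delta_p^Gu=\frac1p|\nabla u|^{2-p}\operatorname{div}(|\nabla u|^{p-2}\nabla u)=\frac1p\Delta u+\frac{p-2}{p}|\nabla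 u|^{-2}\sum_{i,j}\frac{\partial u}{\partial x_i}\frac{\partial u}{\partial x_j}\frac{\partial^2u}{\partial x_i\partial x_j}.$$ *)

theory Defs
  imports "HOL-Analysis.Analysis"
begin

definition partial_deriv :: "'n::finite \<Rightarrow> (real^'n \<Rightarrow> real) \<Rightarrow> real^'n \<Rightarrow> real" where
  "partial_deriv i f x = deriv (\<lambda>t. f (x + t *\<^sub>R axis i 1)) 0"

primrec iter_partial_deriv :: "'n::finite list \<Rightarrow> (real^'n \<Rightarrow> real) \<Rightarrow> real^'n \<Rightarrow> real" where
  "iter_partial_deriv [] f = f"
| "iter_partial_deriv (i # is) f = partial_deriv i (iter_partial_deriv is f)"

definition gradient :: "(real^'n::finite \<Rightarrow> real) \<Rightarrow> real^'n \<Rightarrow> real^'n" where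
  "gradient f x = (\<chi> i. partial_deriv i f x)"

definition divergence :: "(real^'n::finite \<Rightarrow> real^'n) \<Rightarrow> real^'n \<Rightarrow> real" where
  "divergence V x = (\<Sum>i\<in>UNIV. partial_deriv i (\<lambda>y. V y $ i) x)"

(* The space C_b^infinity(S), for open S: since every partial derivative of every order
   (including order 0) is required to be Frechet differentiable on S, all of them are
   continuous, so f is smooth on S. Values of f outside S play no role. *)
definition Cb_infinity :: "(real^'n::finite) set \<Rightarrow> (real^'n \<Rightarrow> real) set" where
  "Cb_infinity S = {f. \<forall>is. iter_partial_deriv is f differentiable_on S \<and>
                            bounded (iter_partial_deriv is f ` S)}"

(* Meaningful at points with nonzero gradient; 0 powr a = 0 by convention. *)
definition game_p_laplacian :: "real \<Rightarrow> (real^'n::finite \<Rightarrow> real) \<Rightarrow> real^'n \<Rightarrow> real" where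
  "game_p_laplacian p u x =
     1 / p * norm (gradient u x) powr (2 - p) *
     divergence (\<lambda>y. norm (gradient u y) powr (p - 2) *\<^sub>R gradient u y) x"

definition polygon_vertex :: "nat \<Rightarrow> real \<Rightarrow> nat \<Rightarrow> real^2" where
  "polygon_vertex m \<epsilon> j = \<epsilon> *\<^sub>R vector [cos (2 * pi * real j / real m), sin (2 * pi * real j / real m)]"

(* For k >= 1 the minimized function of c is strictly convex and coercive, so the
   minimizer exists and is unique. *)
definition polygon_average :: "nat \<Rightarrow> real \<Rightarrow> (real^2 \<Rightarrow> real) \<Rightarrow> real^2 \<Rightarrow> real" where
  "polygon_average k \<epsilon> \<phi> x =
     (THE c. is_arg_min
        (\<lambda>c::real. \<Sum>j = 0..2*k+1. \<bar>\<phi> (x + polygon_vertex (2*k+2) \<epsilon> j) - c\<bar> ^ (2*k))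
        (\<lambda>_. True) c)"

definition unit_enlargement :: "(real^2) set \<Rightarrow> (real^2) set" where
  "unit_enlargement \<Omega> = {x. infdist x \<Omega> < 1}"

end

theory Submission
  imports Defs
begin

text \<open>
  Write \<open>v\<^sub>j\<close> for the vertices of the regular \<open>(2k+2)\<close>-gon on the unit circle. The minimizer \<open>c\<close> of
  \<open>\<Sum>\<^sub>j |\<phi>(x + \<epsilon> v\<^sub>j) - c|^(2k)\<close> is the zero of the strictly decreasing function
  \<open>\<Sum>\<^sub>j (\<phi>(x + \<epsilon> v\<^sub>j) - c)^(2k-1)\<close>. Put \<open>c = \<phi>(x) + \<epsilon>\<^sup>2 \<tau>\<close>, and expand
  \<open>\<phi>(x + \<epsilon> v\<^sub>j) = \<phi>(x) + \<epsilon> a\<^sub>j + \<epsilon>\<^sup>2 b\<^sub>j + O(\<epsilon>\<^sup>3)\<close> with \<open>a\<^sub>j = \<nabla>\<phi>(x) \<bullet> v\<^sub>j\<close> and \<open>b\<^sub>j\<close> half of the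
  Hessian form at \<open>v\<^sub>j\<close>. After division by \<open>\<epsilon>^(2k-1)\<close> the function becomes
  \<open>\<Sum>\<^sub>j a\<^sub>j^(2k-1) + (2k-1) \<epsilon> \<Sum>\<^sub>j a\<^sub>j^(2k-2) (b\<^sub>j - \<tau>) + O(\<epsilon>\<^sup>2)\<close>.
  The first sum vanishes, so to leading order \<open>\<tau>\<close> must be the mean \<open>t\<close> of the \<open>b\<^sub>j\<close> with the
  weights \<open>a\<^sub>j^(2k-2)\<close>.

  That \<open>t\<close> is half of the game Laplacian with \<open>p = 2k\<close> is where the number of vertices matters:
  \<open>2k+2\<close> equispaced points integrate trigonometric polynomials of degree at most \<open>2k\<close> exactly, so
  the weighted mean does not depend on how the polygon is turned relative to the gradient, and
  equals the mean over the circle (\<open>sum_cos_power_equispaced\<close>, \<open>cos_moments_equispaced\<close>). There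
  the second derivatives in the direction of the gradient and orthogonal to it get the weights
  \<open>(2k-1)/(2k)\<close> and \<open>1/(2k)\<close>, which are those of the game Laplacian
  (\<open>game_p_laplacian_expand\<close>, \<open>polygon_weighted_average\<close>).

  The asymptotic root need not be inverted: for a fixed \<open>\<delta> > 0\<close> and small \<open>\<epsilon>\<close> the decreasing
  function is positive at \<open>\<tau> = t - \<delta>\<close> and negative at \<open>\<tau> = t + \<delta>\<close>
  (\<open>perturbed_power_sum_sign\<close>), which traps the minimizer
  (\<open>power_mean_minimizer_between\<close>). Uniformity in \<open>x\<close> holds because every constant depends only
  on bounds for the derivatives of \<open>\<phi>\<close> and on a positive lower bound for its gradient; the latter
  exists because the closure of \<open>\<Omega>\<close> is a compact subset of the enlarged domain
  (\<open>gradient_norm_bounds\<close>).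
\<close>

section \<open>Power sums of the cosine at equispaced points\<close>

text \<open>
  For \<open>q \<noteq> 0\<close> this is a geometric sum whose ratio is an \<open>m\<close>-th root of unity; the ratio differs
  from \<open>1\<close> because \<open>m\<close> does not divide \<open>q\<close>.
\<close>

lemma sum_cis_equispaced:
  fixes q :: int and m :: nat and \<alpha> :: real
  assumes "\<bar>q\<bar> < int m"
  shows "(\<Sum>j<m. cis (real_of_int q * (2 * pi * real j / real m - \<alpha>))) = (if q = 0 then of_nat m else 0)"
proof (cases "q = 0")
  case False
  define w where "w = cis (2 * pi * real_of_int q / real m)"
  have m: "m > 0" using assms by linarith
  have "w \<noteq> 1"
  proof
    assume "w = 1"
    then have "cos (2 * pi * real_of_int q / real m) = 1"
      unfolding w_def by (metis cis.simps(1) one_complex.simps(1))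
    then obtain i :: int where "2 * pi * real_of_int q / real m = real_of_int i * 2 * pi"
      using cos_one_2pi_int by blast
    then have "real_of_int q = real_of_int (i * int m)"
      using m by (simp add: field_simps)
    then have "q = i * int m" by linarith
    then show False using assms False
      by (metis abs_of_nat abs_mult dvd_triv_right zdvd_not_zless abs_ge_zero dvd_abs_iff zero_less_abs_iff)
  qed
  have "w ^ m = cis (2 * pi * real_of_int q)"
    unfolding w_def Complex.DeMoivre using m by (intro arg_cong[of _ _ cis]) simp
  also have "\<dots> = 1" by (rule cis_multiple_2pi) simp
  finally have wm: "w ^ m = 1" .
  have "cis (real_of_int q * (2 * pi * real j / real m - \<alpha>)) = cis (- real_of_int q * \<alpha>) * w ^ j" for j
    unfolding w_def Complex.DeMoivre cis_mult by (rule arg_cong[of _ _ cis]) (simp add: field_simps)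
  then have "(\<Sum>j<m. cis (real_of_int q * (2 * pi * real j / real m - \<alpha>)))
      = cis (- real_of_int q * \<alpha>) * (\<Sum>j<m. w ^ j)"
    by (simp add: sum_distrib_left)
  also have "(\<Sum>j<m. w ^ j) = 0"
    using \<open>w \<noteq> 1\<close> wm by (simp add: geometric_sum)
  finally show ?thesis using False by simp
qed simp

text \<open>
  The binomial expansion of \<open>cos x = (e^(ix) + e^(-ix)) / 2\<close> contains only frequencies of modulus at
  most \<open>n < m\<close>, so summation over the \<open>m\<close> points kills all of them except frequency zero. What
  matters below is that the value is the same for every phase \<open>\<alpha>\<close>, and zero for odd \<open>n\<close>.
\<close>

lemma sum_cos_power_equispaced:
  fixes n m :: nat and \<alpha> :: real
  assumes "n < m"
  shows "(\<Sum>j<m. cos (2 * pi * real j / real m - \<alpha>) ^ n)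
       = (if even n then real m * real (n choose (n div 2)) / 2 ^ n else 0)"
proof -
  define x where "x j = 2 * pi * real j / real m - \<alpha>" for j
  have expand: "complex_of_real (cos (x j) ^ n)
      = (\<Sum>l\<le>n. of_nat (n choose l) * cis (real_of_int (2 * int l - int n) * x j)) / 2 ^ n" for j
  proof -
    have "complex_of_real (cos (x j)) = (cis (x j) + cis (- x j)) / 2"
      by (simp add: complex_eq_iff)
    then have "complex_of_real (cos (x j) ^ n) = (cis (x j) + cis (- x j)) ^ n / 2 ^ n"
      by (simp only: of_real_power power_divide)
    also have "(cis (x j) + cis (- x j)) ^ n
        = (\<Sum>l\<le>n. of_nat (n choose l) * cis (x j) ^ l * cis (- x j) ^ (n - l))"
      by (rule binomial_ring)
    also have "\<dots> = (\<Sum>l\<le>n. of_nat (n choose l) * cis (real_of_int (2 * int l - int n) * x j))"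
    proof (rule sum.cong[OF refl])
      fix l assume "l \<in> {..n}"
      then have "real l * x j + real (n - l) * (- x j) = real_of_int (2 * int l - int n) * x j"
        by (simp add: of_nat_diff algebra_simps)
      then show "of_nat (n choose l) * cis (x j) ^ l * cis (- x j) ^ (n - l)
          = of_nat (n choose l) * cis (real_of_int (2 * int l - int n) * x j)"
        by (simp add: Complex.DeMoivre cis_mult mult.assoc)
    qed
    finally show ?thesis .
  qed
  have "complex_of_real (\<Sum>j<m. cos (x j) ^ n)
      = (\<Sum>j<m. (\<Sum>l\<le>n. of_nat (n choose l) * cis (real_of_int (2 * int l - int n) * x j))) / 2 ^ n"
    unfolding of_real_sum expand sum_divide_distrib ..
  also have "\<dots> = (\<Sum>l\<le>n. of_nat (n choose l) * (\<Sum>j<m. cis (real_of_int (2 * int l - int n) * x j))) / 2 ^ n"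
    by (subst sum.swap) (simp add: sum_distrib_left)
  also have "\<dots> = (\<Sum>l\<le>n. of_nat (n choose l) * (if 2 * int l - int n = 0 then of_nat m else 0)) / 2 ^ n"
  proof -
    have "(\<Sum>j<m. cis (real_of_int (2 * int l - int n) * x j)) = (if 2 * int l - int n = 0 then of_nat m else 0)"
      if "l \<in> {..n}" for l
      unfolding x_def using that assms by (intro sum_cis_equispaced) auto
    then show ?thesis by simp
  qed
  also have "\<dots> = (\<Sum>l\<le>n. if 2 * l = n then of_nat (n choose l) * of_nat m else 0) / 2 ^ n"
    by (intro arg_cong[of _ _ "\<lambda>z. z / 2 ^ n"] sum.cong) auto
  also have "\<dots> = complex_of_real (if even n then real m * real (n choose (n div 2)) / 2 ^ n else 0)"
  proof (cases "even n")
    case True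
    then have "(\<Sum>l\<le>n. if 2 * l = n then of_nat (n choose l) * of_nat m else 0)
        = (\<Sum>l\<le>n. if l = n div 2 then (of_nat (n choose l) * of_nat m :: complex) else 0)"
      by (intro sum.cong) auto
    also have "\<dots> = of_nat (n choose (n div 2)) * of_nat m"
      by simp
    finally show ?thesis using True by (simp add: mult.commute)
  next
    case False
    then have "(\<Sum>l\<le>n. if 2 * l = n then (of_nat (n choose l) * of_nat m :: complex) else 0) = 0"
      by (intro sum.neutral) auto
    with False show ?thesis by simp
  qed
  finally show ?thesis unfolding x_def of_real_eq_iff .
qed

text \<open>
  As a function of the phase, \<open>\<Sum>\<^sub>j cos(x\<^sub>j)^(2k)\<close> is constant. Its first derivative gives the first
  identity and its second derivative the other two, which are the discrete counterparts of the
  reduction formula for \<open>\<integral> cos^(2k)\<close>.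
\<close>

lemma cos_moments_equispaced:
  fixes m k :: nat and \<alpha> :: real
  assumes "k \<ge> 1" "2 * k < m"
  defines "x \<equiv> \<lambda>j. 2 * pi * real j / real m - \<alpha>"
  shows "(\<Sum>j<m. cos (x j) ^ (2*k-1) * sin (x j)) = 0"
    and "(\<Sum>j<m. cos (x j) ^ (2*k-2) * (sin (x j))\<^sup>2) = (\<Sum>j<m. cos (x j) ^ (2*k)) / real (2*k-1)"
    and "(\<Sum>j<m. cos (x j) ^ (2*k-2)) = real (2*k) / real (2*k-1) * (\<Sum>j<m. cos (x j) ^ (2*k))"
proof -
  define F where "F b = (\<Sum>j<m. cos (2 * pi * real j / real m - b) ^ (2*k))" for b
  define F1 where "F1 b = (\<Sum>j<m. cos (2 * pi * real j / real m - b) ^ (2*k-1) * sin (2 * pi * real j / real m - b))" for b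
  have "F b = real m * real (2*k choose k) / 2 ^ (2*k)" for b
    unfolding F_def using assms(2) by (simp add: sum_cos_power_equispaced)
  then have Fconst: "F = (\<lambda>_. F 0)" by auto
  have "(F has_real_derivative real (2*k) * F1 b) (at b)" for b
    unfolding F_def[abs_def] F1_def sum_distrib_left
    by (rule DERIV_sum) (auto intro!: derivative_eq_intros)
  moreover have "(F has_real_derivative 0) (at b)" for b
    by (subst Fconst) simp
  ultimately have "real (2*k) * F1 b = 0" for b
    by (metis DERIV_unique)
  then have F1: "F1 = (\<lambda>_. 0)" using assms(1) by auto
  then show "(\<Sum>j<m. cos (x j) ^ (2*k-1) * sin (x j)) = 0"
    unfolding F1_def x_def by meson
  have "(F1 has_real_derivative (\<Sum>j<m. real (2*k-1) * (cos (x j) ^ (2*k-2) * (sin (x j))\<^sup>2) - cos (x j) ^ (2*k))) (at \<alpha>)"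
    unfolding F1_def[abs_def]
  proof (rule DERIV_sum)
    fix j
    have pw: "cos (x j) ^ (2*k) = cos (x j) ^ (2*k-1) * cos (x j)"
      using assms(1) by (metis One_nat_def Suc_pred mult_pos_pos less_le_trans power_Suc2 zero_less_one zero_less_numeral)
    have e: "2*k - Suc (Suc 0) = 2*k-2" by simp
    show "((\<lambda>b. cos (2 * pi * real j / real m - b) ^ (2*k-1) * sin (2 * pi * real j / real m - b))
        has_real_derivative real (2*k-1) * (cos (x j) ^ (2*k-2) * (sin (x j))\<^sup>2) - cos (x j) ^ (2*k)) (at \<alpha>)"
      unfolding pw
      by (rule derivative_eq_intros refl | simp add: x_def e power2_eq_square)+
  qed
  moreover have "(F1 has_real_derivative 0) (at \<alpha>)"
    by (subst F1) simp
  ultimately have "(\<Sum>j<m. real (2*k-1) * (cos (x j) ^ (2*k-2) * (sin (x j))\<^sup>2) - cos (x j) ^ (2*k)) = 0"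
    by (rule DERIV_unique)
  then have eq: "real (2*k-1) * (\<Sum>j<m. cos (x j) ^ (2*k-2) * (sin (x j))\<^sup>2) = (\<Sum>j<m. cos (x j) ^ (2*k))"
    by (simp add: sum_subtractf sum_distrib_left)
  have pos: "real (2*k-1) > 0" using assms(1) by simp
  show sin2: "(\<Sum>j<m. cos (x j) ^ (2*k-2) * (sin (x j))\<^sup>2) = (\<Sum>j<m. cos (x j) ^ (2*k)) / real (2*k-1)"
    using eq pos by (simp add: field_simps)
  have "2*k = 2*k-2+2" using assms(1) by simp
  then have "cos (x j) ^ (2*k) = cos (x j) ^ (2*k-2) * (cos (x j))\<^sup>2" for j
    by (metis power_add)
  then have "cos (x j) ^ (2*k-2) = cos (x j) ^ (2*k) + cos (x j) ^ (2*k-2) * (sin (x j))\<^sup>2" for j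
    by (simp add: distrib_left[symmetric])
  then have "(\<Sum>j<m. cos (x j) ^ (2*k-2)) = (\<Sum>j<m. cos (x j) ^ (2*k)) + (\<Sum>j<m. cos (x j) ^ (2*k-2) * (sin (x j))\<^sup>2)"
    by (metis (no_types, lifting) sum.cong sum.distrib)
  also have "\<dots> = real (2*k) / real (2*k-1) * (\<Sum>j<m. cos (x j) ^ (2*k))"
    unfolding sin2 using assms(1) by (simp add: field_simps of_nat_diff)
  finally show "(\<Sum>j<m. cos (x j) ^ (2*k-2)) = real (2*k) / real (2*k-1) * (\<Sum>j<m. cos (x j) ^ (2*k))" .
qed

section \<open>Taylor expansion of functions with bounded derivatives\<close>

lemma iter_partial_deriv_append:
  "iter_partial_deriv (is @ js) f = iter_partial_deriv is (iter_partial_deriv js f)"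
  by (induction "is") auto

lemma Cb_infinity_partial_deriv:
  assumes "f \<in> Cb_infinity S" shows "partial_deriv i f \<in> Cb_infinity S"
proof -
  have "iter_partial_deriv is (partial_deriv i f) = iter_partial_deriv (is @ [i]) f" for "is"
    by (simp add: iter_partial_deriv_append)
  then show ?thesis using assms unfolding Cb_infinity_def by auto
qed

lemma Cb_infinity_bounded:
  assumes "f \<in> Cb_infinity S"
  obtains B where "B \<ge> 0" "\<And>x. x \<in> S \<Longrightarrow> \<bar>f x\<bar> \<le> B"
proof -
  have "bounded (iter_partial_deriv [] f ` S)"
    using assms unfolding Cb_infinity_def by blast
  then obtain B where "\<forall>y\<in>f ` S. norm y \<le> B" unfolding bounded_iff by auto
  then show ?thesis using that[of "max B 0"] by (auto simp: le_max_iff_disj)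
qed

lemma Cb_infinity_differentiable:
  assumes "open S" "f \<in> Cb_infinity S" "x \<in> S"
  shows "f differentiable (at x)"
proof -
  have "iter_partial_deriv [] f differentiable_on S"
    using assms unfolding Cb_infinity_def by blast
  then show ?thesis using assms by (simp add: differentiable_on_eq_differentiable_at)
qed

lemma has_derivative_partial_deriv:
  fixes f :: "real^'n::finite \<Rightarrow> real"
  assumes "f differentiable (at x)"
  shows "(f has_derivative (\<lambda>v. \<Sum>i\<in>UNIV. v $ i * partial_deriv i f x)) (at x)"
proof -
  obtain D where D: "(f has_derivative D) (at x)"
    using assms unfolding differentiable_def by blast
  interpret D: bounded_linear D using D by (rule has_derivative_bounded_linear)
  have pd: "partial_deriv i f x = D (axis i 1)" for i
  proof -
    have line: "((\<lambda>t. x + t *\<^sub>R axis i 1) has_derivative (\<lambda>t. t *\<^sub>R axis i 1)) (at 0)"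
      by (auto intro!: derivative_eq_intros)
    have "((\<lambda>t. f (x + t *\<^sub>R axis i 1)) has_derivative (\<lambda>t. D (t *\<^sub>R axis i 1))) (at 0)"
      using has_derivative_compose[OF line, of f D] D by simp
    then have "((\<lambda>t. f (x + t *\<^sub>R axis i 1)) has_real_derivative D (axis i 1)) (at 0)"
      unfolding has_field_derivative_def
      by (rule has_derivative_eq_rhs) (simp add: fun_eq_iff D.scaleR)
    then show ?thesis unfolding partial_deriv_def by (rule DERIV_imp_deriv)
  qed
  have "D v = (\<Sum>i\<in>UNIV. v $ i * partial_deriv i f x)" for v
  proof -
    have "D v = D (\<Sum>i\<in>UNIV. v $ i *\<^sub>R axis i 1)"
      by (simp add: basis_expansion scalar_mult_eq_scaleR[symmetric])
    then show ?thesis unfolding pd by (simp add: D.sum D.scaleR)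
  qed
  then have "D = (\<lambda>v. \<Sum>i\<in>UNIV. v $ i * partial_deriv i f x)" by auto
  with D show ?thesis by simp
qed

lemma has_real_derivative_along_line:
  fixes f :: "real^'n::finite \<Rightarrow> real"
  assumes "open S" "f \<in> Cb_infinity S" "x + t *\<^sub>R v \<in> S"
  shows "((\<lambda>t. f (x + t *\<^sub>R v)) has_real_derivative
            (\<Sum>i\<in>UNIV. v $ i * partial_deriv i f (x + t *\<^sub>R v))) (at t)"
proof -
  have "(f has_derivative (\<lambda>w. \<Sum>i\<in>UNIV. w $ i * partial_deriv i f (x + t *\<^sub>R v))) (at (x + t *\<^sub>R v))"
    by (rule has_derivative_partial_deriv[OF Cb_infinity_differentiable[OF assms]])
  then have "((\<lambda>t. f (x + t *\<^sub>R v)) has_derivative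
      (\<lambda>s. \<Sum>i\<in>UNIV. (s *\<^sub>R v) $ i * partial_deriv i f (x + t *\<^sub>R v))) (at t)"
    by (rule has_derivative_compose[rotated]) (auto intro!: derivative_eq_intros)
  then show ?thesis
    unfolding has_field_derivative_def
    by (rule has_derivative_eq_rhs) (auto simp: sum_distrib_left mult_ac)
qed

definition hessian_form :: "(real^'n::finite \<Rightarrow> real) \<Rightarrow> real^'n \<Rightarrow> real^'n \<Rightarrow> real^'n \<Rightarrow> real" where
  "hessian_form u x v w =
     (\<Sum>i\<in>UNIV. \<Sum>j\<in>UNIV. v $ i * w $ j * partial_deriv i (partial_deriv j u) x)"

text \<open>
  Maclaurin's formula for the restriction of \<open>f\<close> to the line through \<open>x\<close> in direction \<open>v\<close>. The
  constant is the sum of the bounds of all third-order partial derivatives, hence independent of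
  the base point and the direction.
\<close>

lemma Taylor_second_order_Cb_infinity:
  fixes f :: "real^'n::finite \<Rightarrow> real"
  assumes S: "open S" and f: "f \<in> Cb_infinity S"
  obtains C where "C \<ge> 0"
    "\<And>x v h. norm v = 1 \<Longrightarrow> 0 < h \<Longrightarrow> (\<And>t. 0 \<le> t \<Longrightarrow> t \<le> h \<Longrightarrow> x + t *\<^sub>R v \<in> S) \<Longrightarrow>
       \<bar>f (x + h *\<^sub>R v) - (f x + h * (gradient f x \<bullet> v) + h\<^sup>2 / 2 * hessian_form f x v v)\<bar> \<le> C * h ^ 3"
proof -
  define d1 where "d1 i = partial_deriv i f" for i
  define d2 where "d2 j i = partial_deriv j (d1 i)" for j i
  define d3 where "d3 l j i = partial_deriv l (d2 j i)" for l j i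
  have cb: "d1 i \<in> Cb_infinity S" "d2 j i \<in> Cb_infinity S" "d3 l j i \<in> Cb_infinity S" for i j l
    unfolding d1_def d2_def d3_def by (intro Cb_infinity_partial_deriv f)+
  have "\<forall>l j i. \<exists>B. B \<ge> 0 \<and> (\<forall>x\<in>S. \<bar>d3 l j i x\<bar> \<le> B)"
    using Cb_infinity_bounded[OF cb(3)] by metis
  then obtain B where B: "\<And>l j i. B l j i \<ge> 0" "\<And>l j i x. x \<in> S \<Longrightarrow> \<bar>d3 l j i x\<bar> \<le> B l j i"
    by metis
  define C where "C = (\<Sum>i\<in>UNIV. \<Sum>j\<in>UNIV. \<Sum>l\<in>UNIV. B l j i)"
  have C0: "C \<ge> 0" unfolding C_def by (intro sum_nonneg B)
  show ?thesis
  proof (rule that[OF C0])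
    fix x v :: "real^'n" and h :: real
    assume v: "norm v = 1" and h: "0 < h" and seg: "\<And>t. 0 \<le> t \<Longrightarrow> t \<le> h \<Longrightarrow> x + t *\<^sub>R v \<in> S"
    \<comment> \<open>\<open>D n\<close> is the \<open>n\<close>-th derivative of \<open>f\<close> along the line, for \<open>n \<le> 3\<close>.\<close>
    define D where "D = (\<lambda>(n::nat) t. if n = 0 then f (x + t *\<^sub>R v)
      else if n = 1 then (\<Sum>i\<in>UNIV. v $ i * d1 i (x + t *\<^sub>R v))
      else if n = 2 then (\<Sum>i\<in>UNIV. v $ i * (\<Sum>j\<in>UNIV. v $ j * d2 j i (x + t *\<^sub>R v)))
      else (\<Sum>i\<in>UNIV. v $ i * (\<Sum>j\<in>UNIV. v $ j * (\<Sum>l\<in>UNIV. v $ l * d3 l j i (x + t *\<^sub>R v)))))"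
    have der: "(D n has_real_derivative D (Suc n) t) (at t)" if n: "n < 3" and t: "0 \<le> t" "t \<le> h" for n t
    proof -
      have S': "x + t *\<^sub>R v \<in> S" using seg t by blast
      note der1 = has_real_derivative_along_line[OF S f S', folded d1_def]
      note der2 = has_real_derivative_along_line[OF S cb(1) S', folded d2_def]
      note der3 = has_real_derivative_along_line[OF S cb(2) S', folded d3_def]
      consider "n = 0" | "n = 1" | "n = 2" using n by linarith
      then show ?thesis
      proof cases
        case 1 then show ?thesis using der1 by (simp add: D_def)
      next
        case 2 then show ?thesis
          by (auto simp: D_def intro!: DERIV_sum DERIV_cmult der2)
      next
        case 3 then show ?thesis
          by (auto simp: D_def intro!: DERIV_sum DERIV_cmult der3)
      qed
    qed
    have "\<exists>t>0. t < h \<and> D 0 h = (\<Sum>m<3. D m 0 / fact m * h ^ m) + D 3 t / fact 3 * h ^ 3"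
      using der by (intro Maclaurin h) auto
    then obtain t where t: "0 < t" "t < h"
      and eq: "D 0 h = (\<Sum>m<3. D m 0 / fact m * h ^ m) + D 3 t / fact 3 * h ^ 3" by blast
    have v1: "\<bar>v $ i\<bar> \<le> 1" for i using component_le_norm_cart[of v i] v by simp
    have "\<bar>D 3 t\<bar> \<le> C"
    proof -
      have prod: "\<bar>v $ i * y\<bar> \<le> b" if "\<bar>y\<bar> \<le> b" for i y b
        using mult_mono[OF v1[of i] that] by (simp add: abs_mult)
      have S': "x + t *\<^sub>R v \<in> S" using seg t by simp
      show ?thesis unfolding D_def C_def
        by (simp, intro order_trans[OF sum_abs] sum_mono prod B(2) S')
    qed
    moreover have "D 0 h - (\<Sum>m<3. D m 0 / fact m * h ^ m) = D 3 t / fact 3 * h ^ 3"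
      using eq by simp
    moreover have "(\<Sum>m<3. D m 0 / fact m * h ^ m) = f x + h * (gradient f x \<bullet> v) + h\<^sup>2 / 2 * hessian_form f x v v"
    proof -
      have "D 1 0 = gradient f x \<bullet> v"
        by (simp add: D_def d1_def gradient_def inner_vec_def mult.commute)
      moreover have "D 2 0 = hessian_form f x v v"
      proof -
        have "D 2 0 = (\<Sum>i\<in>UNIV. \<Sum>j\<in>UNIV. v $ i * v $ j * d2 j i x)"
          by (simp add: D_def sum_distrib_left mult.assoc)
        also have "\<dots> = hessian_form f x v v"
          unfolding hessian_form_def d2_def d1_def by (subst sum.swap) (simp add: mult_ac)
        finally show ?thesis .
      qed
      moreover have "D 0 0 = f x" by (simp add: D_def)
      ultimately show ?thesis by (simp add: eval_nat_numeral lessThan_Suc)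
    qed
    ultimately have "f (x + h *\<^sub>R v) - (f x + h * (gradient f x \<bullet> v) + h\<^sup>2 / 2 * hessian_form f x v v)
        = D 3 t / fact 3 * h ^ 3" by (simp add: D_def)
    also have "\<bar>\<dots>\<bar> \<le> C * h ^ 3"
    proof -
      have "\<bar>D 3 t / fact 3\<bar> \<le> \<bar>D 3 t\<bar>" by (simp add: fact_numeral)
      then have "\<bar>D 3 t / fact 3\<bar> \<le> C" using \<open>\<bar>D 3 t\<bar> \<le> C\<close> by simp
      then have "\<bar>D 3 t / fact 3\<bar> * h ^ 3 \<le> C * h ^ 3" using h by (intro mult_right_mono) auto
      then show ?thesis using h by (simp add: abs_mult)
    qed
    finally show "\<bar>f (x + h *\<^sub>R v) - (f x + h * (gradient f x \<bullet> v) + h\<^sup>2 / 2 * hessian_form f x v v)\<bar> \<le> C * h ^ 3" .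
  qed
qed

section \<open>The game p-Laplacian in non-divergence form\<close>

text \<open>
  The product rule, applied with \<open>|\<nabla>u|^(p-2)\<close> written as \<open>(\<nabla>u \<bullet> \<nabla>u)^((p-2)/2)\<close>, whose base is
  positive and differentiable where the gradient does not vanish.
\<close>

lemma game_p_laplacian_expand:
  fixes u :: "real^'n::finite \<Rightarrow> real"
  assumes S: "open S" and u: "u \<in> Cb_infinity S" and x: "x \<in> S" and nz: "gradient u x \<noteq> 0"
  shows "game_p_laplacian p u x =
     1 / p * (\<Sum>i\<in>UNIV. partial_deriv i (partial_deriv i u) x)
     + (p - 2) / p * (hessian_form u x (gradient u x) (gradient u x) / (norm (gradient u x))\<^sup>2)"
proof -
  define g where "g = gradient u x"
  define N where "N = g \<bullet> g"
  define H where "H i j = partial_deriv i (partial_deriv j u) x" for i j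
  have Npos: "N > 0" using nz by (simp add: N_def g_def)
  have pw: "norm y powr a = (y \<bullet> y) powr (a / 2)" for y :: "real^'n" and a
    by (simp add: norm_eq_sqrt_inner powr_half_sqrt[symmetric] powr_powr)
  have part: "partial_deriv i (\<lambda>y. (norm (gradient u y) powr (p - 2) *\<^sub>R gradient u y) $ i) x
     = N powr ((p - 2) / 2) * H i i + (p - 2) * N powr ((p - 2) / 2) / N * (\<Sum>j\<in>UNIV. g $ i * g $ j * H i j)" for i
  proof -
    define G where "G j t = partial_deriv j u (x + t *\<^sub>R axis i 1)" for j t
    have G0: "G j 0 = g $ j" for j by (simp add: G_def g_def gradient_def)
    have dG: "(G j has_real_derivative H i j) (at 0)" for j
    proof -
      have "x + 0 *\<^sub>R axis i 1 \<in> S" using x by simp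
      from has_real_derivative_along_line[OF S Cb_infinity_partial_deriv[OF u] this, of j]
      have "(G j has_real_derivative (\<Sum>l\<in>UNIV. axis i 1 $ l * H l j)) (at 0)"
        by (simp add: G_def[abs_def] H_def)
      also have "(\<Sum>l\<in>UNIV. axis i 1 $ l * H l j) = (\<Sum>l\<in>UNIV. if l = i then H l j else 0)"
        by (intro sum.cong) (auto simp: axis_def)
      finally show ?thesis by simp
    qed
    have N0: "(\<Sum>j\<in>UNIV. G j 0 * G j 0) = N"
      by (simp add: G0 N_def inner_vec_def)
    have dN: "((\<lambda>t. \<Sum>j\<in>UNIV. G j t * G j t) has_real_derivative 2 * (\<Sum>j\<in>UNIV. g $ j * H i j)) (at 0)"
      unfolding sum_distrib_left
      by (rule DERIV_sum) (auto intro!: derivative_eq_intros dG simp: G0)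
    have dP: "((\<lambda>t. (\<Sum>j\<in>UNIV. G j t * G j t) powr ((p - 2) / 2)) has_real_derivative
        (p - 2) / 2 * N powr ((p - 2) / 2 - 1) * (2 * (\<Sum>j\<in>UNIV. g $ j * H i j))) (at 0)"
      using DERIV_fun_powr[OF dN, of "(p - 2) / 2"] Npos by (simp add: N0)
    have "((\<lambda>t. (\<Sum>j\<in>UNIV. G j t * G j t) powr ((p - 2) / 2) * G i t) has_real_derivative
       (p - 2) / 2 * N powr ((p - 2) / 2 - 1) * (2 * (\<Sum>j\<in>UNIV. g $ j * H i j)) * g $ i
       + H i i * N powr ((p - 2) / 2)) (at 0)"
      using DERIV_mult[OF dP dG[of i]] unfolding N0 unfolding G0 .
    moreover have "(\<lambda>t. (norm (gradient u (x + t *\<^sub>R axis i 1)) powr (p - 2) *\<^sub>R gradient u (x + t *\<^sub>R axis i 1)) $ i)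
        = (\<lambda>t. (\<Sum>j\<in>UNIV. G j t * G j t) powr ((p - 2) / 2) * G i t)"
      unfolding pw by (simp add: gradient_def inner_vec_def G_def)
    ultimately have pd: "partial_deriv i (\<lambda>y. (norm (gradient u y) powr (p - 2) *\<^sub>R gradient u y) $ i) x
      = (p - 2) / 2 * N powr ((p - 2) / 2 - 1) * (2 * (\<Sum>j\<in>UNIV. g $ j * H i j)) * g $ i
       + H i i * N powr ((p - 2) / 2)"
      unfolding partial_deriv_def[of i "\<lambda>y. (norm (gradient u y) powr (p - 2) *\<^sub>R gradient u y) $ i"]
      by (simp only: DERIV_imp_deriv)
    have pdiv: "N powr ((p - 2) / 2 - 1) = N powr ((p - 2) / 2) / N"
      using Npos by (simp add: powr_diff)
    have sumeq: "(\<Sum>j\<in>UNIV. g $ i * g $ j * H i j) = g $ i * (\<Sum>j\<in>UNIV. g $ j * H i j)"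
      by (simp add: sum_distrib_left mult.assoc)
    show ?thesis unfolding pd pdiv sumeq using Npos by (simp add: field_simps)
  qed
  have hf: "hessian_form u x g g = (\<Sum>i\<in>UNIV. \<Sum>j\<in>UNIV. g $ i * g $ j * H i j)"
    by (simp add: hessian_form_def H_def)
  have div: "divergence (\<lambda>y. norm (gradient u y) powr (p - 2) *\<^sub>R gradient u y) x
      = N powr ((p - 2) / 2) * ((\<Sum>i\<in>UNIV. H i i) + (p - 2) / N * hessian_form u x g g)"
    unfolding divergence_def part hf
    by (simp only: sum.distrib sum_distrib_left[symmetric]) (simp add: algebra_simps)
  have "norm g powr (2 - p) * N powr ((p - 2) / 2) = N powr ((2 - p) / 2 + (p - 2) / 2)"
    unfolding pw N_def[symmetric] by (rule powr_add[symmetric])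
  also have "\<dots> = 1" using Npos by (simp add: field_simps)
  finally have one: "norm g powr (2 - p) * N powr ((p - 2) / 2) = 1" .
  have "game_p_laplacian p u x = 1 / p * (norm g powr (2 - p) * N powr ((p - 2) / 2))
       * ((\<Sum>i\<in>UNIV. H i i) + (p - 2) / N * hessian_form u x g g)"
    unfolding game_p_laplacian_def div g_def[symmetric] by (simp add: mult.assoc)
  then show ?thesis unfolding one
    by (simp add: g_def[symmetric] H_def N_def power2_norm_eq_inner distrib_left)
qed

section \<open>Locating the minimizer\<close>

text \<open>
  The derivative in \<open>c\<close> of the minimized function is \<open>-2k\<close> times the strictly decreasing function
  \<open>\<Sum>\<^sub>j (y\<^sub>j - c)^(2k-1)\<close>. So the minimizer exists, is unique, and is the only zero of that
  function; a sign change therefore locates it.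
\<close>

lemma power_mean_minimizer_between:
  fixes y :: "'a \<Rightarrow> real" and J :: "'a set"
  assumes k: "k \<ge> 1" and J: "finite J" "J \<noteq> {}"
    and lo: "(\<Sum>j\<in>J. (y j - a) ^ (2*k-1)) > 0" and hi: "(\<Sum>j\<in>J. (y j - b) ^ (2*k-1)) < 0"
  shows "(THE c. is_arg_min (\<lambda>c. \<Sum>j\<in>J. \<bar>y j - c\<bar> ^ (2*k)) (\<lambda>_. True) c) \<in> {a<..<b}"
proof -
  define G where "G c = (\<Sum>j\<in>J. (y j - c) ^ (2*k-1))" for c
  define F where "F c = (\<Sum>j\<in>J. \<bar>y j - c\<bar> ^ (2*k))" for c
  have F_eq: "F = (\<lambda>c. \<Sum>j\<in>J. (y j - c) ^ (2*k))"
    unfolding F_def by (simp add: power_even_abs)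
  have dF: "(F has_real_derivative - real (2*k) * G c) (at c)" for c
    unfolding F_eq G_def sum_distrib_left
    by (rule DERIV_sum) (auto intro!: derivative_eq_intros)
  have odd: "odd (2*k-1)" using k by simp
  have power_strict: "w ^ (2*k-1) < z ^ (2*k-1)" if "w < z" for w z :: real
    using power_mono_odd[OF odd, of w z] odd_real_root_power_cancel[OF odd, of w]
      odd_real_root_power_cancel[OF odd, of z] that
    by (metis order_less_imp_le order_le_imp_less_or_eq less_irrefl)
  have G_mono: "G d < G c" if "c < d" for c d
    unfolding G_def using that J by (intro sum_strict_mono power_strict) auto
  have "a < b"
    using G_mono[of b a] lo hi unfolding G_def[symmetric] by (cases a b rule: linorder_cases) auto
  have "continuous_on {a..b} G" unfolding G_def by (intro continuous_intros)
  then obtain c0 where c0: "a \<le> c0" "c0 \<le> b" "G c0 = 0"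
    using IVT2'[of G b 0 a] lo hi \<open>a < b\<close> unfolding G_def[symmetric] by auto
  have kpos: "real (2*k) > 0" using k by simp
  have min: "F c0 < F c" if "c \<noteq> c0" for c
  proof (cases "c < c0")
    case True
    obtain z where z: "c < z" "z < c0" "F c0 - F c = (c0 - c) * (- real (2*k) * G z)"
      using MVT2[OF True, of F "\<lambda>c. - real (2*k) * G c"] dF by blast
    have "G z > 0" using G_mono[OF z(2)] c0 by simp
    then have "(c0 - c) * (real (2*k) * G z) > 0" using True kpos by (intro mult_pos_pos) auto
    moreover have "F c0 - F c = - ((c0 - c) * (real (2*k) * G z))"
      using z(3) by (simp only: mult_minus_left mult_minus_right)
    ultimately show ?thesis by linarith
  next
    case False
    then have less: "c0 < c" using that by simp
    obtain z where z: "c0 < z" "z < c" "F c - F c0 = (c - c0) * (- real (2*k) * G z)"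
      using MVT2[OF less, of F "\<lambda>c. - real (2*k) * G c"] dF by blast
    have "- G z > 0" using G_mono[OF z(1)] c0 by simp
    then have "(c - c0) * (real (2*k) * (- G z)) > 0" using less kpos by (intro mult_pos_pos) auto
    moreover have "F c - F c0 = (c - c0) * (real (2*k) * (- G z))"
      using z(3) by (simp only: mult_minus_left mult_minus_right)
    ultimately show ?thesis by linarith
  qed
  have "(THE c. is_arg_min F (\<lambda>_. True) c) = c0"
  proof (rule the_equality)
    show "is_arg_min F (\<lambda>_. True) c0"
      unfolding is_arg_min_def using min by (metis order_less_asym)
    show "c = c0" if "is_arg_min F (\<lambda>_. True) c" for c
      using that min unfolding is_arg_min_def by blast
  qed
  moreover have "a \<noteq> c0" "c0 \<noteq> b" using c0 lo hi unfolding G_def by auto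
  ultimately show ?thesis using c0 unfolding F_def[abs_def] by simp
qed

section \<open>Uniform perturbation of a power sum\<close>

text \<open>The point is that \<open>K\<close> depends only on \<open>B\<close> and \<open>n\<close>.\<close>

lemma power_linearization_bound:
  fixes B :: real
  assumes B: "B \<ge> 0"
  obtains K where "K \<ge> 0"
    "\<And>a h e. \<bar>a\<bar> \<le> B \<Longrightarrow> \<bar>h\<bar> \<le> B \<Longrightarrow> 0 \<le> e \<Longrightarrow> e \<le> 1 \<Longrightarrow>
       \<bar>(a + e * h) ^ n - a ^ n - real n * a ^ (n - 1) * (e * h)\<bar> \<le> K * e\<^sup>2"
proof -
  have "\<exists>K\<ge>0. \<forall>a h e. \<bar>a\<bar> \<le> B \<longrightarrow> \<bar>h\<bar> \<le> B \<longrightarrow> 0 \<le> e \<longrightarrow> e \<le> 1 \<longrightarrow>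
       \<bar>(a + e * h) ^ n - a ^ n - real n * a ^ (n - 1) * (e * h)\<bar> \<le> K * e\<^sup>2"
  proof (induction n)
    case 0
    then show ?case by (intro exI[of _ 0]) auto
  next
    case (Suc n)
    then obtain K where K: "K \<ge> 0" and IH: "\<And>a h e. \<bar>a\<bar> \<le> B \<Longrightarrow> \<bar>h\<bar> \<le> B \<Longrightarrow> 0 \<le> e \<Longrightarrow> e \<le> 1 \<Longrightarrow>
       \<bar>(a + e * h) ^ n - a ^ n - real n * a ^ (n - 1) * (e * h)\<bar> \<le> K * e\<^sup>2"
      by blast
    define K' where "K' = real n * B ^ (n - 1) * B\<^sup>2 + 2 * B * K"
    have "\<bar>(a + e * h) ^ Suc n - a ^ Suc n - real (Suc n) * a ^ (Suc n - 1) * (e * h)\<bar> \<le> K' * e\<^sup>2"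
      if a: "\<bar>a\<bar> \<le> B" and h: "\<bar>h\<bar> \<le> B" and e: "0 \<le> e" "e \<le> 1" for a h e :: real
    proof -
      define R where "R = (a + e * h) ^ n - a ^ n - real n * a ^ (n - 1) * (e * h)"
      have "real n * a ^ (n - 1) * a = real n * a ^ n"
        by (cases n) auto
      then have *: "real n * (a * a ^ (n - 1)) = real n * a ^ n" by (simp add: mult_ac)
      have p: "(a + e * h) ^ n = R + a ^ n + real n * a ^ (n - 1) * (e * h)" by (simp add: R_def)
      have "(a + e * h) ^ Suc n - a ^ Suc n - real (Suc n) * a ^ (Suc n - 1) * (e * h)
          = (real n * (a * a ^ (n - 1)) - real n * a ^ n) * (e * h) + real n * a ^ (n - 1) * h\<^sup>2 * e\<^sup>2 + (a + e * h) * R"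
        unfolding power_Suc p by (simp add: algebra_simps power2_eq_square)
      then have eq: "(a + e * h) ^ Suc n - a ^ Suc n - real (Suc n) * a ^ (Suc n - 1) * (e * h)
          = real n * a ^ (n - 1) * h\<^sup>2 * e\<^sup>2 + (a + e * h) * R" unfolding * by simp
      have "\<bar>real n * a ^ (n - 1) * h\<^sup>2 * e\<^sup>2\<bar> = real n * \<bar>a\<bar> ^ (n - 1) * \<bar>h\<bar>\<^sup>2 * e\<^sup>2"
        by (simp add: abs_mult power_abs)
      also have "\<dots> \<le> real n * B ^ (n - 1) * B\<^sup>2 * e\<^sup>2"
        using a h B by (intro mult_right_mono mult_mono power_mono) auto
      finally have 1: "\<bar>real n * a ^ (n - 1) * h\<^sup>2 * e\<^sup>2\<bar> \<le> real n * B ^ (n - 1) * B\<^sup>2 * e\<^sup>2" .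
      have "\<bar>a + e * h\<bar> \<le> \<bar>a\<bar> + e * \<bar>h\<bar>" using e by (metis abs_mult abs_of_nonneg abs_triangle_ineq)
      also have "\<dots> \<le> B + 1 * B" using a h e by (intro add_mono mult_mono) auto
      finally have "\<bar>a + e * h\<bar> * \<bar>R\<bar> \<le> (2 * B) * (K * e\<^sup>2)"
        using IH[OF a h e] B by (intro mult_mono) (auto simp: R_def)
      then have 2: "\<bar>(a + e * h) * R\<bar> \<le> 2 * B * K * e\<^sup>2" by (simp add: abs_mult)
      show ?thesis unfolding eq K'_def using 1 2 abs_triangle_ineq[of "real n * a ^ (n - 1) * h\<^sup>2 * e\<^sup>2" "(a + e * h) * R"]
        by (simp add: distrib_right)
    qed
    moreover have "K' \<ge> 0" unfolding K'_def using B K by auto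
    ultimately show ?case by blast
  qed
  then show ?thesis using that by blast
qed

text \<open>
  The base point \<open>t\<close> is the mean of the \<open>b\<^sub>j\<close> with weights \<open>a\<^sub>j^(n-1)\<close>, so shifting it by \<open>s\<close> turns
  the first-order coefficient from \<open>0\<close> into \<open>-n s \<Sum>\<^sub>j a\<^sub>j^(n-1)\<close>, which has size at least
  \<open>n |s| \<mu>\<close> and dominates the \<open>O(\<epsilon>\<^sup>2)\<close> error for small \<open>\<epsilon>\<close>. The threshold \<open>\<epsilon>0\<close> depends only on
  \<open>J\<close>, \<open>n\<close>, \<open>B\<close>, \<open>\<mu>\<close> and \<open>s\<close>, and not on the data \<open>a\<close>, \<open>b\<close>, \<open>r\<close>, \<open>t\<close>; this is the source of
  uniformity in \<open>x\<close>.
\<close>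

lemma perturbed_power_sum_sign:
  fixes J :: "'a set" and B \<mu> s :: real and n :: nat
  assumes J: "finite J" and n: "odd n" and B: "B \<ge> 0" and \<mu>: "\<mu> > 0" and s: "s \<noteq> 0"
  obtains \<epsilon>0 where "\<epsilon>0 > 0"
    "\<And>\<epsilon> a b r t. 0 < \<epsilon> \<Longrightarrow> \<epsilon> < \<epsilon>0 \<Longrightarrow>
       (\<And>j. j \<in> J \<Longrightarrow> \<bar>a j\<bar> \<le> B \<and> \<bar>b j\<bar> \<le> B \<and> \<bar>r j\<bar> \<le> B) \<Longrightarrow>
       (\<Sum>j\<in>J. a j ^ n) = 0 \<Longrightarrow> (\<Sum>j\<in>J. a j ^ (n - 1) * (b j - t)) = 0 \<Longrightarrow>
       (\<Sum>j\<in>J. a j ^ (n - 1)) \<ge> \<mu> \<Longrightarrow>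
       s * (\<Sum>j\<in>J. (\<epsilon> * a j + \<epsilon>\<^sup>2 * b j + \<epsilon> ^ 3 * r j - \<epsilon>\<^sup>2 * (t + s)) ^ n) < 0"
proof -
  \<comment> \<open>\<open>B'\<close> bounds \<open>b j - t - s + \<epsilon> * r j\<close> when \<open>\<epsilon> \<le> 1\<close>, since \<open>t\<close> is a weighted mean of the \<open>b j\<close>.\<close>
  define B' where "B' = 3 * B + \<bar>s\<bar>"
  have B': "B' \<ge> 0" "B \<le> B'" using B by (auto simp: B'_def)
  obtain K where K: "K \<ge> 0" and lin: "\<And>a h e. \<bar>a\<bar> \<le> B' \<Longrightarrow> \<bar>h\<bar> \<le> B' \<Longrightarrow> 0 \<le> e \<Longrightarrow> e \<le> 1 \<Longrightarrow>
       \<bar>(a + e * h) ^ n - a ^ n - real n * a ^ (n - 1) * (e * h)\<bar> \<le> K * e\<^sup>2"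
    using power_linearization_bound[OF B'(1), of n] by blast
  \<comment> \<open>\<open>L * \<epsilon>\<^sup>2\<close> bounds the total error: linearization, plus the contribution of \<open>r\<close> to the linear
    term. The summand \<open>1\<close> only makes \<open>L\<close> positive.\<close>
  define L where "L = real (card J) * (K + real n * B ^ (n - 1) * B) + 1"
  have Lpos: "L > 0" unfolding L_def using K B by (intro add_nonneg_pos mult_nonneg_nonneg add_nonneg_nonneg) auto
  define \<epsilon>0 where "\<epsilon>0 = min 1 (real n * \<bar>s\<bar> * \<mu> / L)"
  have "\<epsilon>0 > 0" unfolding \<epsilon>0_def using odd_pos[OF n] s \<mu> Lpos by auto
  moreover have "s * (\<Sum>j\<in>J. (\<epsilon> * a j + \<epsilon>\<^sup>2 * b j + \<epsilon> ^ 3 * r j - \<epsilon>\<^sup>2 * (t + s)) ^ n) < 0"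
    if \<epsilon>: "0 < \<epsilon>" "\<epsilon> < \<epsilon>0"
      and bd: "\<And>j. j \<in> J \<Longrightarrow> \<bar>a j\<bar> \<le> B \<and> \<bar>b j\<bar> \<le> B \<and> \<bar>r j\<bar> \<le> B"
      and A: "(\<Sum>j\<in>J. a j ^ n) = 0" and Ab: "(\<Sum>j\<in>J. a j ^ (n - 1) * (b j - t)) = 0"
      and A\<mu>: "(\<Sum>j\<in>J. a j ^ (n - 1)) \<ge> \<mu>" for \<epsilon> t :: real and a b r
  proof -
    define h where "h j = b j - t - s + \<epsilon> * r j" for j
    have e1: "\<epsilon> < 1" and e2: "\<epsilon> * L < real n * \<bar>s\<bar> * \<mu>"
      using \<epsilon> Lpos by (auto simp: \<epsilon>0_def field_simps)
    define P where "P = (\<Sum>j\<in>J. a j ^ (n - 1))"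
    have t: "\<bar>t\<bar> \<le> B"
    proof -
      have w: "a j ^ (n - 1) \<ge> 0" for j using n by (intro zero_le_even_power) simp
      have Ppos: "P > 0" using A\<mu> \<mu> unfolding P_def by linarith
      have "P * t = (\<Sum>j\<in>J. a j ^ (n - 1) * b j)"
        using Ab unfolding P_def by (simp add: right_diff_distrib sum_subtractf sum_distrib_right)
      then have "P * \<bar>t\<bar> = \<bar>\<Sum>j\<in>J. a j ^ (n - 1) * b j\<bar>" using Ppos by (metis abs_mult abs_of_pos)
      also have "\<dots> \<le> (\<Sum>j\<in>J. \<bar>a j ^ (n - 1) * b j\<bar>)" by (rule sum_abs)
      also have "\<dots> = (\<Sum>j\<in>J. a j ^ (n - 1) * \<bar>b j\<bar>)"
        unfolding abs_mult using w by simp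
      also have "\<dots> \<le> (\<Sum>j\<in>J. a j ^ (n - 1) * B)"
        using bd w by (intro sum_mono mult_left_mono) auto
      also have "\<dots> = P * B" by (simp add: P_def sum_distrib_right)
      finally show ?thesis using Ppos by simp
    qed
    define Q where "Q = (\<Sum>j\<in>J. (a j + \<epsilon> * h j) ^ n)"
    have fac: "(\<Sum>j\<in>J. (\<epsilon> * a j + \<epsilon>\<^sup>2 * b j + \<epsilon> ^ 3 * r j - \<epsilon>\<^sup>2 * (t + s)) ^ n) = \<epsilon> ^ n * Q"
      unfolding Q_def sum_distrib_left power_mult_distrib[symmetric]
      by (intro sum.cong arg_cong[of _ _ "\<lambda>z. z ^ n"])
         (simp_all add: h_def algebra_simps power2_eq_square power3_eq_cube)
    have err: "\<bar>(a j + \<epsilon> * h j) ^ n - a j ^ n - real n * \<epsilon> * (a j ^ (n - 1) * (b j - t - s))\<bar>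
        \<le> (K + real n * B ^ (n - 1) * B) * \<epsilon>\<^sup>2" if j: "j \<in> J" for j
    proof -
      have er: "\<bar>\<epsilon> * r j\<bar> \<le> B"
        using mult_mono[of \<epsilon> 1 "\<bar>r j\<bar>" B] bd[OF j] e1 \<epsilon> B by (simp add: abs_mult)
      have "\<bar>h j\<bar> \<le> B'" using bd[OF j] t er unfolding h_def B'_def by linarith
      moreover have "\<bar>a j\<bar> \<le> B'" using bd[OF j] B' by linarith
      ultimately have 1: "\<bar>(a j + \<epsilon> * h j) ^ n - a j ^ n - real n * a j ^ (n - 1) * (\<epsilon> * h j)\<bar> \<le> K * \<epsilon>\<^sup>2"
        using \<epsilon> e1 by (intro lin) auto
      have "\<bar>real n * a j ^ (n - 1) * r j * \<epsilon>\<^sup>2\<bar> = real n * \<bar>a j\<bar> ^ (n - 1) * \<bar>r j\<bar> * \<epsilon>\<^sup>2"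
        by (simp add: abs_mult power_abs)
      also have "\<dots> \<le> real n * B ^ (n - 1) * B * \<epsilon>\<^sup>2"
        using bd[OF j] B by (intro mult_right_mono mult_mono power_mono) auto
      finally have 2: "\<bar>real n * a j ^ (n - 1) * r j * \<epsilon>\<^sup>2\<bar> \<le> real n * B ^ (n - 1) * B * \<epsilon>\<^sup>2" .
      have "(a j + \<epsilon> * h j) ^ n - a j ^ n - real n * \<epsilon> * (a j ^ (n - 1) * (b j - t - s))
          = ((a j + \<epsilon> * h j) ^ n - a j ^ n - real n * a j ^ (n - 1) * (\<epsilon> * h j)) + real n * a j ^ (n - 1) * r j * \<epsilon>\<^sup>2"
        by (simp add: h_def algebra_simps power2_eq_square)
      then show ?thesis
        using 1 2 by (simp only: distrib_right) (rule order_trans[OF abs_triangle_ineq add_mono])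
    qed
    have "Q + real n * \<epsilon> * s * P
        = (\<Sum>j\<in>J. (a j + \<epsilon> * h j) ^ n - a j ^ n - real n * \<epsilon> * (a j ^ (n - 1) * (b j - t - s)))"
    proof -
      have "(\<Sum>j\<in>J. a j ^ (n - 1) * (b j - t - s)) = 0 - s * P"
        unfolding Ab[symmetric] P_def sum_distrib_left sum_subtractf[symmetric]
        by (intro sum.cong) (auto simp: algebra_simps)
      then show ?thesis
        unfolding sum_subtractf A Q_def[symmetric] sum_distrib_left[symmetric] by simp
    qed
    also have "\<bar>\<dots>\<bar> \<le> (\<Sum>j\<in>J. (K + real n * B ^ (n - 1) * B) * \<epsilon>\<^sup>2)"
      by (intro order_trans[OF sum_abs] sum_mono err)
    also have "\<dots> \<le> L * \<epsilon>\<^sup>2" by (simp add: L_def algebra_simps)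
    finally have Q: "\<bar>Q + real n * \<epsilon> * s * P\<bar> \<le> L * \<epsilon>\<^sup>2" .
    have "L * \<epsilon>\<^sup>2 = (\<epsilon> * L) * \<epsilon>" by (simp add: power2_eq_square)
    also have "\<dots> < (real n * \<bar>s\<bar> * \<mu>) * \<epsilon>" using e2 \<epsilon> by (intro mult_strict_right_mono)
    also have "\<dots> \<le> (real n * \<bar>s\<bar> * P) * \<epsilon>"
      using A\<mu> \<epsilon> unfolding P_def by (intro mult_right_mono mult_left_mono) auto
    finally have QP: "\<bar>Q + real n * \<epsilon> * s * P\<bar> < real n * \<epsilon> * \<bar>s\<bar> * P"
      using Q by (simp add: mult_ac)
    have "s * Q < 0"
    proof (cases "s > 0")
      case True
      then have "Q < 0" using QP by (simp add: abs_less_iff)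
      with True show ?thesis by (simp add: mult_pos_neg)
    next
      case False
      then have "s < 0" using s by simp
      then have "Q > 0" using QP by (simp add: abs_less_iff)
      with \<open>s < 0\<close> show ?thesis by (simp add: mult_neg_pos)
    qed
    then have "\<epsilon> ^ n * (s * Q) < 0" by (rule mult_pos_neg[rotated]) (simp add: \<epsilon>)
    then show ?thesis unfolding fac by (simp add: mult_ac)
  qed
  ultimately show ?thesis using that by blast
qed

section \<open>Averages of a quadratic form over the vertices of a polygon\<close>

lemma polygon_vertex_unit:
  "polygon_vertex m \<epsilon> j = \<epsilon> *\<^sub>R polygon_vertex m 1 j" "norm (polygon_vertex m 1 j) = 1"
  by (simp_all add: polygon_vertex_def norm_vec_def L2_set_def sum_2)

text \<open>
  In polar coordinates \<open>\<nabla>u(x) = r (cos \<alpha>, sin \<alpha>)\<close>, the scalar products with the vertices are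
  \<open>r cos(X\<^sub>j)\<close>, where \<open>X\<^sub>j\<close> is the angle from the gradient to the \<open>j\<close>-th vertex. In the orthonormal
  frame given by the gradient direction and its normal, the Hessian form at \<open>v\<^sub>j\<close> is
  \<open>cos\<^sup>2(X\<^sub>j) Hn + cos(X\<^sub>j) sin(X\<^sub>j) Hm + sin\<^sup>2(X\<^sub>j) Ht\<close>, and its weighted sum is read off from the
  moments of the cosine: the mixed term drops out and \<open>Hn\<close>, \<open>Ht\<close> are weighted in the
  ratio \<open>2k-1 : 1\<close>, as in the game Laplacian.
\<close>

lemma polygon_weighted_average:
  fixes u :: "real^2 \<Rightarrow> real" and k :: nat
  assumes k: "k \<ge> 1" and S: "open S" and u: "u \<in> Cb_infinity S" and x: "x \<in> S"
    and nz: "gradient u x \<noteq> 0"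
  defines "v \<equiv> polygon_vertex (2*k+2) 1"
  shows "(\<Sum>j<2*k+2. (gradient u x \<bullet> v j) ^ (2*k-1)) = 0"
    and "(\<Sum>j<2*k+2. (gradient u x \<bullet> v j) ^ (2*k-2)) \<ge> norm (gradient u x) ^ (2*k-2)"
    and "(\<Sum>j<2*k+2. (gradient u x \<bullet> v j) ^ (2*k-2)
            * (hessian_form u x (v j) (v j) - game_p_laplacian (2 * real k) u x)) = 0"
proof -
  define g where "g = gradient u x"
  obtain r \<alpha> where g1: "g $ 1 = r * cos \<alpha>" and g2: "g $ 2 = r * sin \<alpha>"
    using polar_Ex by blast
  define X where "X j = 2 * pi * real j / real (2*k+2) - \<alpha>" for j
  have v1: "v j $ 1 = cos (X j) * cos \<alpha> - sin (X j) * sin \<alpha>"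
    and v2: "v j $ 2 = sin (X j) * cos \<alpha> + cos (X j) * sin \<alpha>" for j
  proof -
    have "v j $ 1 = cos (X j + \<alpha>)" "v j $ 2 = sin (X j + \<alpha>)"
      by (simp_all add: v_def polygon_vertex_def X_def)
    then show "v j $ 1 = cos (X j) * cos \<alpha> - sin (X j) * sin \<alpha>"
      "v j $ 2 = sin (X j) * cos \<alpha> + cos (X j) * sin \<alpha>"
      by (simp_all add: cos_add sin_add)
  qed
  have sc: "(sin \<alpha>)\<^sup>2 = 1 - (cos \<alpha>)\<^sup>2" by (simp add: sin_squared_eq)
  have gv: "g \<bullet> v j = r * cos (X j)" for j
  proof -
    have "g \<bullet> v j = r * cos (X j) * ((cos \<alpha>)\<^sup>2 + (sin \<alpha>)\<^sup>2)"
      by (simp add: inner_vec_def sum_2 g1 g2 v1 v2 algebra_simps power2_eq_square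
          del: sin_cos_squared_add sin_cos_squared_add2 sin_cos_squared_add3)
    then show ?thesis by simp
  qed
  have gg: "(norm g)\<^sup>2 = r\<^sup>2"
  proof -
    have "(norm g)\<^sup>2 = r\<^sup>2 * ((cos \<alpha>)\<^sup>2 + (sin \<alpha>)\<^sup>2)"
      unfolding power2_norm_eq_inner
      by (simp add: inner_vec_def sum_2 g1 g2 algebra_simps power2_eq_square
          del: sin_cos_squared_add sin_cos_squared_add2 sin_cos_squared_add3)
    then show ?thesis by simp
  qed
  then have rg: "\<bar>r\<bar> = norm g" by (metis norm_ge_zero real_sqrt_abs real_sqrt_unique)
  then have r: "r \<noteq> 0" using nz by (auto simp: g_def[symmetric])
  have "(\<Sum>j<2*k+2. cos (X j) ^ (2*k-1)) = 0"
    unfolding X_def using k by (subst sum_cos_power_equispaced) auto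
  then show "(\<Sum>j<2*k+2. (gradient u x \<bullet> v j) ^ (2*k-1)) = 0"
    unfolding g_def[symmetric] gv power_mult_distrib by (simp only: sum_distrib_left[symmetric])
  define M where "M = (\<Sum>j<2*k+2. cos (X j) ^ (2*k))"
  \<comment> \<open>\<open>M\<close> may be computed with phase \<open>0\<close>, where the vertex \<open>j = 0\<close> alone contributes \<open>1\<close>.\<close>
  have mean: "M = (\<Sum>j<2*k+2. cos (2 * pi * real j / real (2*k+2) - 0) ^ (2*k))"
    unfolding M_def X_def by (subst (1 2) sum_cos_power_equispaced) auto
  have "cos (2 * pi * real 0 / real (2*k+2) - 0) ^ (2*k) \<le> M"
    unfolding mean by (rule member_le_sum) auto
  then have M1: "M \<ge> 1" by simp
  note mom = cos_moments_equispaced[OF k, of "2*k+2" \<alpha>, folded X_def, folded M_def]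
  have m1: "(\<Sum>j<2*k+2. cos (X j) ^ (2*k-1) * sin (X j)) = 0"
    and m2: "(\<Sum>j<2*k+2. cos (X j) ^ (2*k-2) * (sin (X j))\<^sup>2) = M / real (2*k-1)"
    and m0: "(\<Sum>j<2*k+2. cos (X j) ^ (2*k-2)) = real (2*k) / real (2*k-1) * M"
    using mom by simp_all
  have ev: "r ^ (2*k-2) = norm g ^ (2*k-2)"
    by (simp add: rg[symmetric] power_even_abs)
  have "1 \<le> real (2*k) / real (2*k-1)" using k by simp
  then have "1 * 1 \<le> real (2*k) / real (2*k-1) * M" using M1 by (intro mult_mono) auto
  then have "norm g ^ (2*k-2) * 1 \<le> norm g ^ (2*k-2) * (real (2*k) / real (2*k-1) * M)"
    by (intro mult_left_mono) simp_all
  then show "(\<Sum>j<2*k+2. (gradient u x \<bullet> v j) ^ (2*k-2)) \<ge> norm (gradient u x) ^ (2*k-2)"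
    unfolding g_def[symmetric] gv power_mult_distrib sum_distrib_left[symmetric] m0 ev
    by simp
  define H where "H i j = partial_deriv i (partial_deriv j u) x" for i j
  have hf: "hessian_form u x w w = (w $ 1)\<^sup>2 * H 1 1 + w $ 1 * w $ 2 * (H 1 2 + H 2 1) + (w $ 2)\<^sup>2 * H 2 2" for w
    by (simp add: hessian_form_def sum_2 H_def algebra_simps power2_eq_square)
  \<comment> \<open>Entries of the Hessian in the frame \<open>(cos \<alpha>, sin \<alpha>)\<close>, \<open>(- sin \<alpha>, cos \<alpha>)\<close>; \<open>Hm\<close> is the sum of the
    two off-diagonal ones.\<close>
  define Hn where "Hn = (cos \<alpha>)\<^sup>2 * H 1 1 + cos \<alpha> * sin \<alpha> * (H 1 2 + H 2 1) + (sin \<alpha>)\<^sup>2 * H 2 2"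
  define Ht where "Ht = (sin \<alpha>)\<^sup>2 * H 1 1 - cos \<alpha> * sin \<alpha> * (H 1 2 + H 2 1) + (cos \<alpha>)\<^sup>2 * H 2 2"
  define Hm where "Hm = - 2 * cos \<alpha> * sin \<alpha> * H 1 1 + ((cos \<alpha>)\<^sup>2 - (sin \<alpha>)\<^sup>2) * (H 1 2 + H 2 1)
      + 2 * cos \<alpha> * sin \<alpha> * H 2 2"
  have hv: "hessian_form u x (v j) (v j) = (cos (X j))\<^sup>2 * Hn + cos (X j) * sin (X j) * Hm + (sin (X j))\<^sup>2 * Ht" for j
    unfolding hf v1 v2 Hn_def Ht_def Hm_def by (simp add: algebra_simps power2_eq_square)
  have hg: "hessian_form u x g g = r\<^sup>2 * Hn"
    unfolding hf g1 g2 Hn_def by (simp add: algebra_simps power2_eq_square)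
  have tr: "H 1 1 + H 2 2 = Hn + Ht"
    unfolding Hn_def Ht_def sc by (simp add: algebra_simps)
  define L where "L = game_p_laplacian (2 * real k) u x"
  have "L = 1 / (2 * real k) * (Hn + Ht) + (2 * real k - 2) / (2 * real k) * Hn"
    unfolding L_def using r
    by (subst game_p_laplacian_expand[OF S u x nz])
       (simp add: g_def[symmetric] hg gg sum_2 H_def[symmetric] tr)
  also have "\<dots> = (real (2*k-1) * Hn + Ht) / real (2*k)"
    using k by (simp add: field_simps of_nat_diff)
  finally have L: "L = (real (2*k-1) * Hn + Ht) / real (2*k)" .
  have summand: "(r * cos (X j)) ^ (2*k-2) * (hessian_form u x (v j) (v j) - L)
      = r ^ (2*k-2) * (Hn * cos (X j) ^ (2*k) + Hm * (cos (X j) ^ (2*k-1) * sin (X j))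
        + Ht * (cos (X j) ^ (2*k-2) * (sin (X j))\<^sup>2) - L * cos (X j) ^ (2*k-2))" for j
  proof -
    obtain l where l: "k = Suc l" using k by (cases k) auto
    show ?thesis unfolding hv l by (simp add: power_mult_distrib algebra_simps power2_eq_square)
  qed
  have "(\<Sum>j<2*k+2. (r * cos (X j)) ^ (2*k-2) * (hessian_form u x (v j) (v j) - L))
      = r ^ (2*k-2) * (Hn * M + Hm * 0 + Ht * (M / real (2*k-1)) - L * (real (2*k) / real (2*k-1) * M))"
    unfolding summand sum_distrib_left[symmetric] sum.distrib sum_subtractf m0 m1 m2 M_def[symmetric] ..
  also have "\<dots> = 0"
    unfolding L using k by (simp add: field_simps of_nat_diff)
  finally show "(\<Sum>j<2*k+2. (gradient u x \<bullet> v j) ^ (2*k-2)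
            * (hessian_form u x (v j) (v j) - game_p_laplacian (2 * real k) u x)) = 0"
    unfolding g_def[symmetric] gv L_def .
qed

lemma hessian_form_bounded:
  fixes f :: "real^'n::finite \<Rightarrow> real"
  assumes f: "f \<in> Cb_infinity S"
  obtains M where "M \<ge> 0" "\<And>x v. x \<in> S \<Longrightarrow> norm v = 1 \<Longrightarrow> \<bar>hessian_form f x v v\<bar> \<le> M"
proof -
  have cb: "partial_deriv i (partial_deriv j f) \<in> Cb_infinity S" for i j
    by (intro Cb_infinity_partial_deriv f)
  have "\<forall>i j. \<exists>B. B \<ge> 0 \<and> (\<forall>x\<in>S. \<bar>partial_deriv i (partial_deriv j f) x\<bar> \<le> B)"
    using Cb_infinity_bounded[OF cb] by metis
  then obtain B where B: "\<And>i j. B i j \<ge> 0"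
    "\<And>i j x. x \<in> S \<Longrightarrow> \<bar>partial_deriv i (partial_deriv j f) x\<bar> \<le> B i j"
    by metis
  show ?thesis
  proof (rule that)
    show "(\<Sum>i\<in>UNIV. \<Sum>j\<in>UNIV. B i j) \<ge> 0" by (intro sum_nonneg B)
    fix x and v :: "real^'n" assume x: "x \<in> S" and v: "norm v = 1"
    have v1: "\<bar>v $ i\<bar> \<le> 1" for i using component_le_norm_cart[of v i] v by simp
    have "\<bar>v $ i * v $ j * partial_deriv i (partial_deriv j f) x\<bar> \<le> 1 * 1 * B i j" for i j
      unfolding abs_mult using v1 B x by (intro mult_mono) auto
    then show "\<bar>hessian_form f x v v\<bar> \<le> (\<Sum>i\<in>UNIV. \<Sum>j\<in>UNIV. B i j)"
      unfolding hessian_form_def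
      by (intro order_trans[OF sum_abs] sum_mono) simp
  qed
qed

section \<open>The asymptotic mean value property\<close>

lemma open_unit_enlargement: "open (unit_enlargement \<Omega>)"
  unfolding unit_enlargement_def by (intro open_Collect_less continuous_intros)

text \<open>
  The closure of \<open>\<Omega>\<close> is compact and consists of points at distance \<open>0\<close> from \<open>\<Omega>\<close>, so it lies in the
  enlarged set, where the gradient is continuous and nonzero.
\<close>

lemma gradient_norm_bounds:
  fixes \<Omega> :: "(real^2) set"
  assumes ne: "\<Omega> \<noteq> {}" and bd: "bounded \<Omega>" and f: "f \<in> Cb_infinity (unit_enlargement \<Omega>)"
    and nz: "\<forall>x\<in>unit_enlargement \<Omega>. gradient f x \<noteq> 0"
  obtains m M where "0 < m" "\<And>x. x \<in> \<Omega> \<Longrightarrow> m \<le> norm (gradient f x) \<and> norm (gradient f x) \<le> M"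
proof -
  have sub: "closure \<Omega> \<subseteq> unit_enlargement \<Omega>"
    using in_closure_iff_infdist_zero[OF ne] by (auto simp: unit_enlargement_def)
  have "continuous_on (unit_enlargement \<Omega>) (partial_deriv i f)" for i
  proof -
    have "iter_partial_deriv [i] f differentiable_on unit_enlargement \<Omega>"
      using f unfolding Cb_infinity_def by blast
    then show ?thesis by (simp add: differentiable_imp_continuous_on)
  qed
  then have "continuous_on (unit_enlargement \<Omega>) (\<lambda>x. norm (gradient f x))"
    unfolding gradient_def by (intro continuous_on_norm continuous_on_vec_lambda)
  then have cont: "continuous_on (closure \<Omega>) (\<lambda>x. norm (gradient f x))"
    using sub continuous_on_subset by blast
  have cl: "compact (closure \<Omega>)" "closure \<Omega> \<noteq> {}" using bd ne by auto
  obtain z where z: "z \<in> closure \<Omega>" "\<forall>x\<in>closure \<Omega>. norm (gradient f z) \<le> norm (gradient f x)"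
    using continuous_attains_inf[OF cl cont] by blast
  obtain w where w: "\<forall>x\<in>closure \<Omega>. norm (gradient f x) \<le> norm (gradient f w)"
    using continuous_attains_sup[OF cl cont] by blast
  show ?thesis
  proof (rule that)
    show "0 < norm (gradient f z)" using z sub nz by auto
    show "norm (gradient f z) \<le> norm (gradient f x) \<and> norm (gradient f x) \<le> norm (gradient f w)"
      if "x \<in> \<Omega>" for x using that z w closure_subset by blast
  qed
qed

theorem theorem3p4:
  fixes k :: nat and \<Omega> :: "(real^2) set" and \<phi> :: "real^2 \<Rightarrow> real"
  assumes "k \<ge> 1"
    and "open \<Omega>" and "connected \<Omega>" and "\<Omega> \<noteq> {}" and "bounded \<Omega>"
    and "\<phi> \<in> Cb_infinity (unit_enlargement \<Omega>)"
    and "\<forall>x\<in>unit_enlargement \<Omega>. gradient \<phi> x \<noteq> 0"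
  shows "uniform_limit \<Omega>
    (\<lambda>\<epsilon> x. (\<phi> x - (polygon_average k \<epsilon> \<phi> x
               + 1/2 * \<epsilon>^2 * (- game_p_laplacian (2 * real k) \<phi> x))) / \<epsilon>^2)
    (\<lambda>_. 0) (at_right 0)"
proof -
  define S where "S = unit_enlargement \<Omega>"
  define v where "v = polygon_vertex (2*k+2) 1"
  note k = assms(1)
  have S: "open S" unfolding S_def by (rule open_unit_enlargement)
  have \<phi>: "\<phi> \<in> Cb_infinity S" and nz: "\<And>x. x \<in> S \<Longrightarrow> gradient \<phi> x \<noteq> 0"
    using assms unfolding S_def by auto
  have nv: "norm (v j) = 1" for j unfolding v_def by (rule polygon_vertex_unit)
  have near: "x + t *\<^sub>R v j \<in> S" if "x \<in> \<Omega>" "0 \<le> t" "t < 1" for x t j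
    using infdist_le[OF that(1), of "x + t *\<^sub>R v j"] that
    by (simp add: S_def unit_enlargement_def dist_norm nv)
  then have sub: "x \<in> S" if "x \<in> \<Omega>" for x
    using that by (metis add.right_neutral order_refl scaleR_zero_left zero_less_one)
  obtain m G where m: "0 < m" and mG: "\<And>x. x \<in> \<Omega> \<Longrightarrow> m \<le> norm (gradient \<phi> x) \<and> norm (gradient \<phi> x) \<le> G"
    using gradient_norm_bounds[OF assms(4-7)] by blast
  obtain M where M: "M \<ge> 0" "\<And>x v. x \<in> S \<Longrightarrow> norm v = 1 \<Longrightarrow> \<bar>hessian_form \<phi> x v v\<bar> \<le> M"
    using hessian_form_bounded[OF \<phi>] by blast
  obtain C where C: "C \<ge> 0"
    "\<And>x v h. norm v = 1 \<Longrightarrow> 0 < h \<Longrightarrow> (\<And>t. 0 \<le> t \<Longrightarrow> t \<le> h \<Longrightarrow> x + t *\<^sub>R v \<in> S) \<Longrightarrow>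
       \<bar>\<phi> (x + h *\<^sub>R v) - (\<phi> x + h * (gradient \<phi> x \<bullet> v) + h\<^sup>2 / 2 * hessian_form \<phi> x v v)\<bar> \<le> C * h ^ 3"
    using Taylor_second_order_Cb_infinity[OF S \<phi>] by blast
  define B where "B = \<bar>G\<bar> + M + C"
  have B: "B \<ge> 0" using M C by (simp add: B_def)
  have odd: "odd (2*k-1)" and e2: "2*k-1-1 = 2*k-2" using k by auto
  have \<mu>: "m ^ (2*k-2) > 0" using m by simp
  show ?thesis
  proof (rule uniform_limitI)
    fix e :: real assume e: "e > 0"
    \<comment> \<open>The same lemma with shifts \<open>e\<close> and \<open>- e\<close> gives the two signs that enclose the average.\<close>
    note sign = perturbed_power_sum_sign[OF finite_lessThan odd B \<mu>, of _ "2*k+2", unfolded e2]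
    obtain \<epsilon>1 where \<epsilon>1: "\<epsilon>1 > 0" "\<And>\<epsilon> a b r t. 0 < \<epsilon> \<Longrightarrow> \<epsilon> < \<epsilon>1 \<Longrightarrow>
       (\<And>j. j \<in> {..<2*k+2} \<Longrightarrow> \<bar>a j\<bar> \<le> B \<and> \<bar>b j\<bar> \<le> B \<and> \<bar>r j\<bar> \<le> B) \<Longrightarrow>
       (\<Sum>j<2*k+2. a j ^ (2*k-1)) = 0 \<Longrightarrow> (\<Sum>j<2*k+2. a j ^ (2*k-2) * (b j - t)) = 0 \<Longrightarrow>
       (\<Sum>j<2*k+2. a j ^ (2*k-2)) \<ge> m ^ (2*k-2) \<Longrightarrow>
       e * (\<Sum>j<2*k+2. (\<epsilon> * a j + \<epsilon>\<^sup>2 * b j + \<epsilon> ^ 3 * r j - \<epsilon>\<^sup>2 * (t + e)) ^ (2*k-1)) < 0"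
      by (rule sign[of e]) (use e in blast)+
    obtain \<epsilon>2 where \<epsilon>2: "\<epsilon>2 > 0" "\<And>\<epsilon> a b r t. 0 < \<epsilon> \<Longrightarrow> \<epsilon> < \<epsilon>2 \<Longrightarrow>
       (\<And>j. j \<in> {..<2*k+2} \<Longrightarrow> \<bar>a j\<bar> \<le> B \<and> \<bar>b j\<bar> \<le> B \<and> \<bar>r j\<bar> \<le> B) \<Longrightarrow>
       (\<Sum>j<2*k+2. a j ^ (2*k-1)) = 0 \<Longrightarrow> (\<Sum>j<2*k+2. a j ^ (2*k-2) * (b j - t)) = 0 \<Longrightarrow>
       (\<Sum>j<2*k+2. a j ^ (2*k-2)) \<ge> m ^ (2*k-2) \<Longrightarrow>
       - e * (\<Sum>j<2*k+2. (\<epsilon> * a j + \<epsilon>\<^sup>2 * b j + \<epsilon> ^ 3 * r j - \<epsilon>\<^sup>2 * (t + - e)) ^ (2*k-1)) < 0"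
      by (rule sign[of "- e"]) (use e in \<open>simp; fail\<close>, blast)
    have "eventually (\<lambda>\<epsilon>. \<epsilon> \<in> {0<..<min 1 (min \<epsilon>1 \<epsilon>2)}) (at_right 0)"
      using \<epsilon>1 \<epsilon>2 by (intro eventually_at_right_real) auto
    then show "\<forall>\<^sub>F \<epsilon> in at_right 0. \<forall>x\<in>\<Omega>. dist ((\<phi> x - (polygon_average k \<epsilon> \<phi> x
               + 1/2 * \<epsilon>^2 * (- game_p_laplacian (2 * real k) \<phi> x))) / \<epsilon>^2) 0 < e"
    proof (rule eventually_mono, intro ballI)
      fix \<epsilon> x assume "\<epsilon> \<in> {0<..<min 1 (min \<epsilon>1 \<epsilon>2)}" and x: "x \<in> \<Omega>"
      then have \<epsilon>: "0 < \<epsilon>" "\<epsilon> < 1" "\<epsilon> < \<epsilon>1" "\<epsilon> < \<epsilon>2" by auto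
      \<comment> \<open>\<open>r j\<close> is the Taylor remainder divided by \<open>\<epsilon> ^ 3\<close>, and \<open>t\<close> the predicted coefficient.\<close>
      define a where "a j = gradient \<phi> x \<bullet> v j" for j
      define b where "b j = hessian_form \<phi> x (v j) (v j) / 2" for j
      define y where "y j = \<phi> (x + polygon_vertex (2*k+2) \<epsilon> j)" for j
      define r where "r j = (y j - (\<phi> x + \<epsilon> * a j + \<epsilon>\<^sup>2 * b j)) / \<epsilon> ^ 3" for j
      define t where "t = game_p_laplacian (2 * real k) \<phi> x / 2"
      have y: "y j = \<phi> (x + \<epsilon> *\<^sub>R v j)" for j
        unfolding y_def v_def by (subst polygon_vertex_unit(1)) simp
      have bounds: "\<bar>a j\<bar> \<le> B \<and> \<bar>b j\<bar> \<le> B \<and> \<bar>r j\<bar> \<le> B" for j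
      proof (intro conjI)
        have "\<bar>a j\<bar> \<le> norm (gradient \<phi> x)"
          using Cauchy_Schwarz_ineq2[of "gradient \<phi> x" "v j"] by (simp add: a_def nv)
        then show "\<bar>a j\<bar> \<le> B" using mG[OF x] M(1) C(1) unfolding B_def by linarith
        show "\<bar>b j\<bar> \<le> B" using M(2)[OF sub[OF x] nv, of j] M C by (simp add: b_def B_def)
        have "x + s *\<^sub>R v j \<in> S" if "0 \<le> s" "s \<le> \<epsilon>" for s
          using near[OF x, of s j] that \<epsilon> by simp
        then have "\<bar>y j - (\<phi> x + \<epsilon> * a j + \<epsilon>\<^sup>2 * b j)\<bar> \<le> C * \<epsilon> ^ 3"
          using C(2)[OF nv \<epsilon>(1), of x j] by (simp add: y a_def b_def)
        then have "\<bar>r j\<bar> \<le> C" using \<epsilon> by (simp add: r_def divide_le_eq)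
        then show "\<bar>r j\<bar> \<le> B" using M by (simp add: B_def)
      qed
      note avg = polygon_weighted_average[OF k S \<phi> sub[OF x] nz[OF sub[OF x]], folded v_def, folded a_def]
      have A: "(\<Sum>j<2*k+2. a j ^ (2*k-1)) = 0" by (rule avg)
      have "m ^ (2*k-2) \<le> norm (gradient \<phi> x) ^ (2*k-2)"
        using mG[OF x] m by (intro power_mono) auto
      then have P: "(\<Sum>j<2*k+2. a j ^ (2*k-2)) \<ge> m ^ (2*k-2)" using avg(2) by linarith
      have "(\<Sum>j<2*k+2. a j ^ (2*k-2) * (b j - t))
         = (\<Sum>j<2*k+2. a j ^ (2*k-2) * (hessian_form \<phi> x (v j) (v j) - game_p_laplacian (2 * real k) \<phi> x)) / 2"
        unfolding sum_divide_distrib by (intro sum.cong) (auto simp: b_def t_def diff_divide_distrib)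
      then have Ab: "(\<Sum>j<2*k+2. a j ^ (2*k-2) * (b j - t)) = 0" using avg(3) by simp
      have shift: "y j - (\<phi> x + \<epsilon>\<^sup>2 * c) = \<epsilon> * a j + \<epsilon>\<^sup>2 * b j + \<epsilon> ^ 3 * r j - \<epsilon>\<^sup>2 * c" for j c
        using \<epsilon> by (simp add: r_def)
      have "e * (\<Sum>j<2*k+2. (y j - (\<phi> x + \<epsilon>\<^sup>2 * (t + e))) ^ (2*k-1)) < 0"
        unfolding shift by (rule \<epsilon>1(2)[OF \<epsilon>(1,3) bounds A Ab P])
      then have hi: "(\<Sum>j<2*k+2. (y j - (\<phi> x + \<epsilon>\<^sup>2 * (t + e))) ^ (2*k-1)) < 0"
        using e by (simp add: mult_less_0_iff)
      have "- e * (\<Sum>j<2*k+2. (y j - (\<phi> x + \<epsilon>\<^sup>2 * (t + - e))) ^ (2*k-1)) < 0"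
        unfolding shift by (rule \<epsilon>2(2)[OF \<epsilon>(1,4) bounds A Ab P])
      then have lo: "(\<Sum>j<2*k+2. (y j - (\<phi> x + \<epsilon>\<^sup>2 * (t + - e))) ^ (2*k-1)) > 0"
        using e by (simp add: zero_less_mult_iff)
      have "{0..2*k+1} = {..<2*k+2}" by auto
      then have "polygon_average k \<epsilon> \<phi> x
          = (THE c. is_arg_min (\<lambda>c. \<Sum>j<2*k+2. \<bar>y j - c\<bar> ^ (2*k)) (\<lambda>_. True) c)"
        unfolding polygon_average_def y_def by simp
      also have "\<dots> \<in> {\<phi> x + \<epsilon>\<^sup>2 * (t + - e)<..<\<phi> x + \<epsilon>\<^sup>2 * (t + e)}"
        by (rule power_mean_minimizer_between[OF k _ _ lo hi]) auto
      finally have "\<bar>\<phi> x - (polygon_average k \<epsilon> \<phi> x + 1/2 * \<epsilon>^2 * (- game_p_laplacian (2 * real k) \<phi> x))\<bar> < e * \<epsilon>\<^sup>2"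
        by (simp add: t_def abs_less_iff algebra_simps)
      then show "dist ((\<phi> x - (polygon_average k \<epsilon> \<phi> x
               + 1/2 * \<epsilon>^2 * (- game_p_laplacian (2 * real k) \<phi> x))) / \<epsilon>^2) 0 < e"
        using \<epsilon> by (simp add: dist_norm pos_divide_less_eq del: mult_minus_right)
    qed
  qed
qed

end
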